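(* Let $G$ be a group and let $\varphi \in \mathrm{End}\, G$ be an endomorphism of $G$. If the $\varphi$-conjugacy class $[e]_{\varphi}$ of the unit element $e$ is a subgroup of $G$, then this subgroup is normal in $G$.
   Context: For a group $G$ and $\varphi\in\mathrm{End}\,G$, write $z^{\varphi}$ for the image of $z$ under $\varphi$. Elements $x,y\in G$ are $\varphi$-conjugated if $y=z^{-1}xz^{\varphi}$ for some $z\in G$; this is an equivalence relation, and the class of $x$ is $[x]_{\varphi}=\{z^{-1}xz^{\varphi}\mid z\in G\}$. In particular $[e]_{\varphi}=\{z^{-1}z^{\varphi}\mid z\in G\}$. *)

theory Defs
  imports "HOL-Algebra.Coset"
begin

definition twisted_conjugated ::
    "('a, 'b) monoid_scheme \<Rightarrow> ('a \<Rightarrow> 'a) \<Rightarrow> 'a \<Rightarrow> 'a \<Rightarrow> bool" where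
  "twisted_conjugated G \<phi> x y \<longleftrightarrow>
     (\<exists>z \<in> carrier G. y = inv\<^bsub>G\<^esub> z \<otimes>\<^bsub>G\<^esub> x \<otimes>\<^bsub>G\<^esub> \<phi> z)"

definition twisted_class ::
    "('a, 'b) monoid_scheme \<Rightarrow> ('a \<Rightarrow> 'a) \<Rightarrow> 'a \<Rightarrow> 'a set" where
  "twisted_class G \<phi> x = {y. twisted_conjugated G \<phi> x y}"

end

theory Submission
  imports Defs
begin

text \<open>
  Write \<open>d z = z\<inverse> \<phi>(z)\<close>, so that the class of the unit is the range of \<open>d\<close>. Since \<open>\<phi>\<close> is
  multiplicative, \<open>d (z w) = (w\<inverse> (d z) w) (d w)\<close>: the map \<open>d\<close> is a crossed homomorphism for
  conjugation. Hence the conjugate \<open>w\<inverse> (d z) w = d (z w) (d w)\<inverse>\<close> is a quotient of two elements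
  of the class, and it lies in the class as soon as the class is a subgroup.
\<close>

lemma (in group) twisted_class_one:
  "twisted_class G \<phi> \<one> = (\<lambda>z. inv z \<otimes> \<phi> z) ` carrier G"
  by (auto simp: twisted_class_def twisted_conjugated_def)

lemma (in group) conj_twisted_commutator:
  assumes hom: "\<phi> \<in> hom G G" and z: "z \<in> carrier G" and w: "w \<in> carrier G"
  shows "inv w \<otimes> (inv z \<otimes> \<phi> z) \<otimes> w
       = (inv (z \<otimes> w) \<otimes> \<phi> (z \<otimes> w)) \<otimes> inv (inv w \<otimes> \<phi> w)"
proof -
  have closed: "\<phi> z \<in> carrier G" "\<phi> w \<in> carrier G"
    using hom z w by (auto simp: hom_def)
  have cancel: "\<phi> w \<otimes> (inv (\<phi> w) \<otimes> w) = w"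
    using closed w by (simp flip: m_assoc)
  show ?thesis
    using z w closed by (simp add: hom_mult[OF hom] inv_mult_group m_assoc cancel)
qed

theorem proposition1:
  fixes G :: "('a, 'b) monoid_scheme" and \<phi> :: "'a \<Rightarrow> 'a"
  assumes "group G"
    and "\<phi> \<in> hom G G"
    and "subgroup (twisted_class G \<phi> \<one>\<^bsub>G\<^esub>) G"
  shows "twisted_class G \<phi> \<one>\<^bsub>G\<^esub> \<lhd> G"
proof -
  interpret group G by fact
  let ?H = "twisted_class G \<phi> \<one>\<^bsub>G\<^esub>"
  note range = twisted_class_one
  have "g \<otimes>\<^bsub>G\<^esub> h \<otimes>\<^bsub>G\<^esub> inv\<^bsub>G\<^esub> g \<in> ?H" if g: "g \<in> carrier G" and h: "h \<in> ?H" for g h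
  proof -
    obtain z where z: "z \<in> carrier G" and h_eq: "h = inv\<^bsub>G\<^esub> z \<otimes>\<^bsub>G\<^esub> \<phi> z"
      using h unfolding range by blast
    let ?w = "inv\<^bsub>G\<^esub> g"
    have "inv\<^bsub>G\<^esub> (z \<otimes>\<^bsub>G\<^esub> ?w) \<otimes>\<^bsub>G\<^esub> \<phi> (z \<otimes>\<^bsub>G\<^esub> ?w) \<in> ?H" "inv\<^bsub>G\<^esub> ?w \<otimes>\<^bsub>G\<^esub> \<phi> ?w \<in> ?H"
      unfolding range using z g by blast+
    then have "inv\<^bsub>G\<^esub> ?w \<otimes>\<^bsub>G\<^esub> h \<otimes>\<^bsub>G\<^esub> ?w \<in> ?H"
      unfolding h_eq conj_twisted_commutator[OF assms(2) z inv_closed[OF g]]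
      by (rule subgroup.m_closed[OF assms(3) _ subgroup.m_inv_closed[OF assms(3)]])
    then show ?thesis
      using g by simp
  qed
  then show ?thesis
    using assms(3) by (simp add: normal_inv_iff)
qed

end
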